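(* For all integers $m\ge 0$ and $n\ge 1$, $$|\mathcal K_n[m]|=|\mathcal S[m]|,$$ i.e. the number of reduced Young walls of type $D^{(2)}_{n+1}$ with $m$ blocks equals the number of strict partitions of $m$.
   Context: A partition is a weakly decreasing sequence $\lambda=(\lambda_1\ge\lambda_2\ge\cdots)$ of non-negative integers, all but finitely many zero; $|\lambda|=\sum_i\lambda_i$. Young walls of type $D^{(2)}_{n+1}$ (built on the ground-state wall $Y_{\Lambda_0}$) consist of columns numbered from right to left, and are encoded by partitions: $\lambda_i$ is the number of blocks in the $i$-th column above the ground-state wall. With $\Delta=n+1$, the set $\mathcal F_n$ of proper Young walls and the set $\mathcal K_n$ of reduced (proper) Young walls are, under this encoding, $$\mathcal F_n=\{\lambda \text{ a partition}\mid \lambda_i=\lambda_{i+1}\text{ implies }\lambda_i=t\Delta\text{ for some }t\in\mathbb Z_{\ge0}\},$$ $$\mathcal K_n=\{\lambda\in\mathcal F_n\mid \lambda_i-\lambda_{i+1}\le 2\Delta\text{ for all } i,\text{ with equality only if }\lambda_i\ne t\Delta\text{ for all }t\in\mathbb Z_{\ge0}\}.$$ The set $\mathcal S$ of strict partitions consists of the partitions $\lambda$ such that $\lambda_i=\lambda_{i+1}$ implies $\lambda_i=0$ (all nonzero parts distinct). For a set $\mathcal A$ of partitions, $\mathcal A[m]$ denotes the set of $\lambda\in\mathcal A$ with $|\lambda|=m$ (walls with $m$ blocks above the ground-state wall). *)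

theory Defs
  imports Main
begin

text \<open>Sequences are indexed from \<open>0\<close>, so that \<open>\<lambda> i\<close> is the part usually written
  \<open>\<lambda>\<close> with index \<open>i + 1\<close>; in particular column \<open>i\<close> of a wall is column \<open>i + 1\<close> from the right.\<close>

definition is_partition :: "(nat \<Rightarrow> nat) \<Rightarrow> bool" where
  "is_partition l \<longleftrightarrow> (\<forall>i. l (Suc i) \<le> l i) \<and> finite {i. l i \<noteq> 0}"

definition psize :: "(nat \<Rightarrow> nat) \<Rightarrow> nat" where
  "psize l = (\<Sum>i | l i \<noteq> 0. l i)"

text \<open>A Young wall of type twisted affine \<open>D\<close> (superscript \<open>(2)\<close>, subscript \<open>n + 1\<close>), built on the
  ground-state wall of \<open>\<Lambda>\<close> with index
  \<open>0\<close>, is encoded by the partition listing the numbers of blocks in its columns above the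
  ground-state wall. The following two sets are the proper and the reduced walls under this
  encoding, with \<open>\<Delta> = n + 1\<close>.\<close>

definition proper_walls :: "nat \<Rightarrow> (nat \<Rightarrow> nat) set" where
  "proper_walls n =
     {l. is_partition l \<and> (\<forall>i. l i = l (Suc i) \<longrightarrow> (\<exists>t. l i = t * (n + 1)))}"

text \<open>The differences below are not truncated, as members of \<open>proper_walls n\<close> are weakly
  decreasing.\<close>

definition reduced_walls :: "nat \<Rightarrow> (nat \<Rightarrow> nat) set" where
  "reduced_walls n =
     {l \<in> proper_walls n. \<forall>i.
        l i - l (Suc i) \<le> 2 * (n + 1) \<and>
        (l i - l (Suc i) = 2 * (n + 1) \<longrightarrow> (\<forall>t. l i \<noteq> t * (n + 1)))}"

definition strict_partitions :: "(nat \<Rightarrow> nat) set" where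
  "strict_partitions = {l. is_partition l \<and> (\<forall>i. l i = l (Suc i) \<longrightarrow> l i = 0)}"

definition of_size :: "(nat \<Rightarrow> nat) set \<Rightarrow> nat \<Rightarrow> (nat \<Rightarrow> nat) set" where
  "of_size A m = {l \<in> A. psize l = m}"

text \<open>There are finitely many partitions of a given size, so \<open>card\<close> of a set \<open>of_size A m\<close> of
  partitions is a genuine count.\<close>

lemma is_partition_le_psize:
  assumes "is_partition l"
  shows "l i \<le> psize l"
proof (cases "l i = 0")
  case False
  then show ?thesis
    using assms unfolding is_partition_def psize_def
    by (intro member_le_sum) auto
qed simp

lemma is_partition_zero:
  assumes "is_partition l" "i \<ge> psize l"
  shows "l i = 0"
proof (rule ccontr)
  assume nz: "l i \<noteq> 0"
  have dec: "l k \<le> l j" if "j \<le> k" for j k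
    using lift_Suc_antimono_le[of l j k] assms(1) that by (simp add: is_partition_def)
  have sub: "{..i} \<subseteq> {i. l i \<noteq> 0}"
    using nz dec by fastforce
  have "card {..i} \<le> (\<Sum>j | l j \<noteq> 0. 1)"
    using card_mono[OF _ sub] assms(1) by (simp add: is_partition_def)
  also have "\<dots> \<le> psize l"
    unfolding psize_def by (intro sum_mono) auto
  finally show False using assms(2) by simp
qed

lemma finite_of_size:
  assumes "\<And>l. l \<in> A \<Longrightarrow> is_partition l"
  shows "finite (of_size A m)"
proof (rule finite_subset)
  show "of_size A m \<subseteq> {l. \<forall>i. (i \<in> {..<m} \<longrightarrow> l i \<in> {..m}) \<and> (i \<notin> {..<m} \<longrightarrow> l i = 0)}"
    using assms is_partition_le_psize is_partition_zero by (auto simp: of_size_def)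
  show "finite {l. \<forall>i. (i \<in> {..<m} \<longrightarrow> l i \<in> {..m}) \<and> (i \<notin> {..<m} \<longrightarrow> l i = (0::nat))}"
    by (rule finite_set_of_finite_funs) auto
qed

end

theory Submission imports Defs begin

text \<open>
  Put \<open>\<Delta> = n + 1\<close>. Both the reduced walls and the strict partitions arise as remainders when a
  proper wall is divided, in two different ways, by an arbitrary partition, and in both cases the
  quotient \<open>c\<close> accounts for \<open>2\<Delta>|c|\<close> blocks.

  \<^item> A partition is a proper wall when every gap between consecutive columns is at least \<open>\<epsilon>\<close>, where \<open>\<epsilon>\<close> is
    \<open>0\<close> or \<open>1\<close> according to whether \<open>\<Delta>\<close> divides the taller of the two columns; it is reduced when
    moreover every gap is less than \<open>\<epsilon> + 2\<Delta>\<close>. Adding \<open>2\<Delta>c\<close> columnwise, with \<open>c\<close> any partition,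
    changes no column modulo \<open>\<Delta>\<close> and hence no \<open>\<epsilon>\<close>, so dividing each gap, less \<open>\<epsilon>\<close>, by \<open>2\<Delta>\<close> writes
    a proper wall uniquely as \<open>r + 2\<Delta>c\<close> with \<open>r\<close> reduced (\<open>bij_reduced_walls\<close>).

  \<^item> In terms of multiplicities of parts, proper walls are the partitions in which only multiples of
    \<open>\<Delta>\<close> may repeat. Taking out equal parts in pairs leaves a strict partition, and the pairs taken
    out form, up to the factor \<open>\<Delta>\<close>, an arbitrary partition. This is carried out on conjugate
    partitions, where multiplicities become gaps and taking out pairs becomes division of the gaps
    by \<open>2\<close> (\<open>card_of_size_conjugate\<close>, \<open>bij_conjugate_strict\<close>).

  Counting proper walls of each size in both ways shows that the two counting sequences in question
  have the same convolution with the numbers of partitions \<open>c\<close>, placed at \<open>2\<Delta>|c|\<close>; since there is a partition of \<open>0\<close>, the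
  convolution can be cancelled (\<open>card_of_size_division\<close>, \<open>convolution_cancel\<close>).
\<close>

section \<open>Partitions and their gaps\<close>

lemma partition_antimono:
  assumes "is_partition l" "i \<le> j"
  shows "l j \<le> l i"
  using lift_Suc_antimono_le[of l i j] assms by (simp add: is_partition_def)

lemma is_partitionI:
  assumes "\<And>i. l (Suc i) \<le> l i" "\<And>i. i \<ge> N \<Longrightarrow> l i = 0"
  shows "is_partition l"
proof -
  have "{i. l i \<noteq> 0} \<subseteq> {..<N}"
    using assms(2) by (metis (mono_tags) lessThan_iff linorder_not_less mem_Collect_eq subsetI)
  then show ?thesis
    using assms(1) finite_subset by (auto simp: is_partition_def)
qed

lemma psize_eq_sum:
  assumes "\<And>i. i \<ge> N \<Longrightarrow> l i = 0"
  shows "psize l = (\<Sum>i<N. l i)"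
proof -
  have "{i. l i \<noteq> 0} \<subseteq> {..<N}"
    using assms by (metis (mono_tags) lessThan_iff linorder_not_less mem_Collect_eq subsetI)
  then show ?thesis
    unfolding psize_def by (intro sum.mono_neutral_left) auto
qed

text \<open>This and the next lemma say that a partition is the same thing as a finitely supported sequence
  of gaps: the parts are the tail sums of the gaps. Gaps can thus be prescribed independently of
  each other, and equations between partitions can be checked gap by gap.\<close>

lemma partition_of_gaps:
  fixes d :: "nat \<Rightarrow> nat"
  assumes "\<And>i. i \<ge> N \<Longrightarrow> d i = 0"
  obtains p where "is_partition p" "\<And>i. p i = p (Suc i) + d i"
proof -
  define p where "p i = (\<Sum>j\<in>{i..<N}. d j)" for i
  have step: "p i = p (Suc i) + d i" for i
  proof (cases "i < N")
    case True
    then show ?thesis by (simp add: p_def sum.atLeast_Suc_lessThan)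
  next
    case False
    then show ?thesis using assms by (simp add: p_def)
  qed
  moreover have "is_partition p"
  proof (rule is_partitionI)
    show "p (Suc i) \<le> p i" for i
      using step[of i] by simp
    show "p i = 0" if "i \<ge> N" for i
      using that by (simp add: p_def)
  qed
  ultimately show thesis by (rule that[rotated])
qed

lemma partition_eqI:
  assumes "is_partition p" "is_partition q"
    and gaps: "\<And>i. p i - p (Suc i) = q i - q (Suc i)"
  shows "p = q"
proof
  fix i
  define N where "N = i + psize p + psize q"
  have "i \<le> N" by (simp add: N_def)
  then show "p i = q i"
  proof (induction rule: inc_induct)
    case base
    have "p N = 0" "q N = 0"
      by (rule is_partition_zero, use assms(1,2) in \<open>simp_all add: N_def\<close>)+
    then show ?case by simp
  next
    case (step k)
    have "p (Suc k) \<le> p k" "q (Suc k) \<le> q k"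
      using assms(1,2) by (simp_all add: is_partition_def)
    then show ?case
      using gaps[of k] step.IH by linarith
  qed
qed

lemma is_partition_add_mult:
  assumes "is_partition r" "is_partition c"
  shows "is_partition (\<lambda>i. r i + M * c i)"
proof (rule is_partitionI)
  show "r (Suc i) + M * c (Suc i) \<le> r i + M * c i" for i
    using assms by (simp add: is_partition_def add_mono)
  show "r i + M * c i = 0" if "i \<ge> psize r + psize c" for i
    using that assms is_partition_zero by simp
qed

lemma psize_add_mult:
  assumes "is_partition r" "is_partition c"
  shows "psize (\<lambda>i. r i + M * c i) = psize r + M * psize c"
proof -
  define N where "N = psize r + psize c"
  have "r i = 0" "c i = 0" if "i \<ge> N" for i
    using that assms is_partition_zero by (simp_all add: N_def)
  then show ?thesis
    by (simp add: psize_eq_sum[of N] sum.distrib sum_distrib_left)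
qed

section \<open>Division of a partition by an integer\<close>

text \<open>Here every gap of \<open>l\<close> is divided by \<open>M\<close>, with remainders taken from the window
  \<open>{e i..<e i + M}\<close> instead of \<open>{0..<M}\<close>. The quotients and the remainders are themselves gaps of
  partitions; the formula for the gaps of \<open>c\<close> shows where the quotient is constant.\<close>

lemma partition_division_exists:
  assumes l: "is_partition l" and M: "M > 0"
    and e: "\<And>i. e i \<le> l i - l (Suc i)"
  obtains r c where "is_partition r" "is_partition c" "l = (\<lambda>i. r i + M * c i)"
    "\<And>i. e i \<le> r i - r (Suc i)" "\<And>i. r i - r (Suc i) < e i + M"
    "\<And>i. c i - c (Suc i) = (l i - l (Suc i) - e i) div M"
proof -
  define q where "q i = (l i - l (Suc i) - e i) div M" for i
  define d where "d i = e i + (l i - l (Suc i) - e i) mod M" for i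
  have split: "l i - l (Suc i) = d i + M * q i" for i
    using e[of i] by (simp add: d_def q_def)
  have zero: "l i - l (Suc i) = 0" if "i \<ge> psize l" for i
    using is_partition_zero[OF l that] by simp
  have "d i = 0" "q i = 0" if "i \<ge> psize l" for i
    using split[of i] zero[OF that] M by simp_all
  then obtain r c where r: "is_partition r" "\<And>i. r i = r (Suc i) + d i"
    and c: "is_partition c" "\<And>i. c i = c (Suc i) + q i"
    using partition_of_gaps[of "psize l"] by metis
  have rd: "r i - r (Suc i) = d i" and cq: "c i - c (Suc i) = q i" for i
    using r(2)[of i] c(2)[of i] by simp_all
  have "l = (\<lambda>i. r i + M * c i)"
  proof (rule partition_eqI[OF l is_partition_add_mult[OF r(1) c(1)]])
    fix i
    have "M * c i = M * c (Suc i) + M * q i"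
      using c(2)[of i] by (simp add: distrib_left)
    then show "l i - l (Suc i) = r i + M * c i - (r (Suc i) + M * c (Suc i))"
      using r(2)[of i] split[of i] by linarith
  qed
  then show thesis
    using that[OF r(1) c(1)] M by (simp add: rd cq d_def q_def)
qed

lemma partition_division_unique:
  assumes r: "is_partition r" "is_partition r'" and c: "is_partition c" "is_partition c'"
    and eq: "(\<lambda>i. r i + M * c i) = (\<lambda>i. r' i + M * c' i)"
    and ge: "\<And>i. e i \<le> r i - r (Suc i)" "\<And>i. e i \<le> r' i - r' (Suc i)"
    and less: "\<And>i. r i - r (Suc i) < e i + M" "\<And>i. r' i - r' (Suc i) < e i + (M::nat)"
  shows "r = r' \<and> c = c'"
proof -
  have quotient: "a i - a (Suc i) =
      (b i + M * a i - (b (Suc i) + M * a (Suc i)) - e i) div M"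
    if "is_partition a" "is_partition b" "e i \<le> b i - b (Suc i)" "b i - b (Suc i) < e i + M"
    for a b i
  proof -
    have "a (Suc i) \<le> a i" "b (Suc i) + e i \<le> b i"
      using that(1,2,3) by (simp_all add: is_partition_def) (metis add.commute le_diff_conv2)
    then obtain x y where x: "a i = a (Suc i) + x" and y: "b i = b (Suc i) + (e i + y)"
      by (metis add.assoc le_Suc_ex)
    have "y < M" using that(4) y by simp
    then show ?thesis by (simp add: x y algebra_simps)
  qed
  have "c = c'"
  proof (rule partition_eqI[OF c])
    fix i
    show "c i - c (Suc i) = c' i - c' (Suc i)"
      using quotient[OF c(1) r(1) ge(1) less(1)] quotient[OF c(2) r(2) ge(2) less(2)]
        fun_cong[OF eq, of i] fun_cong[OF eq, of "Suc i"] by metis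
  qed
  moreover from this have "r = r'"
    using eq by (auto simp: fun_eq_iff)
  ultimately show ?thesis by simp
qed

section \<open>Reduced walls as remainders of proper walls\<close>

lemma proper_walls_iff:
  "l \<in> proper_walls n \<longleftrightarrow>
     is_partition l \<and> (\<forall>i. l i = l (Suc i) \<longrightarrow> Suc n dvd l i)"
  by (auto simp: proper_walls_def dvd_def mult.commute)

text \<open>The offset \<open>of_bool (\<not> Suc n dvd l i)\<close> is what puts propriety and reducedness into the form of
  a division with remainder: it forbids the gap \<open>0\<close> below a column whose height is not a multiple of
  \<open>Suc n\<close>, and it is exactly the amount by which the largest gap of a reduced wall increases there.\<close>

lemma proper_walls_gap_ge:
  assumes "l \<in> proper_walls n"
  shows "of_bool (\<not> Suc n dvd l i) \<le> l i - l (Suc i)"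
  using assms unfolding proper_walls_iff is_partition_def
  by (metis (full_types) One_nat_def Suc_leI le0 le_neq_implies_less of_bool_eq(1,2) zero_less_diff)

lemma reduced_walls_iff:
  "l \<in> reduced_walls n \<longleftrightarrow> is_partition l \<and>
     (\<forall>i. of_bool (\<not> Suc n dvd l i) \<le> l i - l (Suc i) \<and>
          l i - l (Suc i) < of_bool (\<not> Suc n dvd l i) + 2 * Suc n)"
    (is "_ \<longleftrightarrow> ?R")
proof -
  have red: "l \<in> reduced_walls n \<longleftrightarrow> l \<in> proper_walls n \<and>
      (\<forall>i. l i - l (Suc i) < of_bool (\<not> Suc n dvd l i) + 2 * Suc n)"
  proof -
    have "(l i - l (Suc i) \<le> 2 * (n + 1) \<and>
        (l i - l (Suc i) = 2 * (n + 1) \<longrightarrow> (\<forall>t. l i \<noteq> t * (n + 1)))) \<longleftrightarrow>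
        l i - l (Suc i) < of_bool (\<not> Suc n dvd l i) + 2 * Suc n" for i
    proof -
      have "(\<forall>t. l i \<noteq> t * (n + 1)) \<longleftrightarrow> \<not> Suc n dvd l i"
        by (auto simp: dvd_def mult.commute)
      then show ?thesis by auto
    qed
    then show ?thesis by (simp only: reduced_walls_def mem_Collect_eq)
  qed
  show ?thesis
  proof
    assume "l \<in> reduced_walls n"
    then show ?R using red proper_walls_gap_ge proper_walls_iff by metis
  next
    assume R: ?R
    have "Suc n dvd l i" if "l i = l (Suc i)" for i
    proof (rule ccontr)
      assume "\<not> Suc n dvd l i"
      then have "1 \<le> l i - l (Suc i)" using R by (metis (full_types) of_bool_eq(2))
      then show False using that by simp
    qed
    with R show "l \<in> reduced_walls n" using red proper_walls_iff by metis
  qed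
qed

lemma bij_reduced_walls:
  "bij_betw (\<lambda>(r, c) i. r i + 2 * Suc n * c i)
     (reduced_walls n \<times> Collect is_partition) (proper_walls n)"
    (is "bij_betw ?f ?A _")
proof -
  \<comment> \<open>Column heights keep their residues, so \<open>l\<close> and its remainder \<open>r\<close> have the same offsets.\<close>
  have res: "Suc n dvd r + 2 * Suc n * c \<longleftrightarrow> Suc n dvd r" for r c
    by (metis dvd_add_left_iff dvd_triv_right dvd_mult2)
  have inj: "inj_on ?f ?A"
  proof (rule inj_onI, clarify)
    fix r c r' c'
    assume *: "r \<in> reduced_walls n" "is_partition c" "r' \<in> reduced_walls n" "is_partition c'"
      and eq: "(\<lambda>i. r i + 2 * Suc n * c i) = (\<lambda>i. r' i + 2 * Suc n * c' i)"
    have same: "Suc n dvd r' i \<longleftrightarrow> Suc n dvd r i" for i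
      using res fun_cong[OF eq, of i] by metis
    show "r = r' \<and> c = c'"
      using * unfolding reduced_walls_iff
      by (intro partition_division_unique[where e = "\<lambda>i. of_bool (\<not> Suc n dvd r i)", OF _ _ _ _ eq])
         (auto simp: same)
  qed
  have sub: "?f x \<in> proper_walls n" if "x \<in> ?A" for x
  proof -
    obtain r c where x: "x = (r, c)" by force
    have r: "is_partition r" "\<And>i. of_bool (\<not> Suc n dvd r i) \<le> r i - r (Suc i)"
      and c: "is_partition c"
      using that by (auto simp: x reduced_walls_iff)
    have "Suc n dvd r i + 2 * Suc n * c i"
      if eq: "r i + 2 * Suc n * c i = r (Suc i) + 2 * Suc n * c (Suc i)" for i
    proof -
      have "r (Suc i) \<le> r i" "2 * Suc n * c (Suc i) \<le> 2 * Suc n * c i"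
        using r c by (simp_all add: is_partition_def del: mult_Suc_right mult_Suc)
      then have "r i = r (Suc i)" using eq by linarith
      then show ?thesis unfolding res using r(2)[of i] by (simp split: if_splits)
    qed
    then show ?thesis
      using is_partition_add_mult[OF r(1) c]
      by (simp add: x proper_walls_iff del: mult_Suc mult_Suc_right)
  qed
  have sur: "l \<in> ?f ` ?A" if l: "l \<in> proper_walls n" for l
  proof -
    have part: "is_partition l" using l by (simp add: proper_walls_iff)
    obtain r c where *: "is_partition r" "is_partition c"
      and eq: "l = (\<lambda>i. r i + 2 * Suc n * c i)"
      and gap: "\<And>i. of_bool (\<not> Suc n dvd l i) \<le> r i - r (Suc i)"
        "\<And>i. r i - r (Suc i) < of_bool (\<not> Suc n dvd l i) + 2 * Suc n"
      by (rule partition_division_exists[OF part, of "2 * Suc n",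
            OF _ proper_walls_gap_ge[OF l]]) (simp, blast)
    have "Suc n dvd l i \<longleftrightarrow> Suc n dvd r i" for i
      unfolding eq by (rule res)
    with * gap have "r \<in> reduced_walls n" by (simp add: reduced_walls_iff)
    with * eq show ?thesis by force
  qed
  show ?thesis
    using inj sub sur unfolding bij_betw_def by blast
qed

section \<open>Conjugation\<close>

definition conjugate :: "(nat \<Rightarrow> nat) \<Rightarrow> nat \<Rightarrow> nat" where
  "conjugate l k = card {i. k < l i}"

text \<open>The sets counted by \<open>conjugate\<close> are initial segments of the natural numbers, so counting them
  amounts to finding their end. The equivalence says that conjugation reflects the diagram.\<close>

lemma less_conjugate_iff:
  assumes "is_partition l"
  shows "i < conjugate l k \<longleftrightarrow> k < l i"
proof -
  let ?A = "{i. k < l i}"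
  have fin: "finite ?A"
    using assms by (auto simp: is_partition_def elim: rev_finite_subset)
  have down: "j \<in> ?A" if "i \<in> ?A" "j \<le> i" for i j
    using partition_antimono[OF assms that(2)] that(1) by simp
  show ?thesis
  proof
    assume "k < l i"
    then have "{..i} \<subseteq> ?A" using down by blast
    then have "card {..i} \<le> card ?A" by (rule card_mono[OF fin])
    then show "i < conjugate l k" by (simp add: conjugate_def)
  next
    assume less: "i < conjugate l k"
    show "k < l i"
    proof (rule ccontr)
      assume "\<not> k < l i"
      then have "?A \<subseteq> {..<i}" using down by (metis lessThan_iff linorder_not_le mem_Collect_eq subsetI)
      then have "card ?A \<le> i" using card_mono[of "{..<i}"] by fastforce
      then show False using less by (simp add: conjugate_def)
    qed
  qed
qed

lemma is_partition_conjugate: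
  assumes "is_partition l"
  shows "is_partition (conjugate l)"
proof (rule is_partitionI)
  show "conjugate l (Suc k) \<le> conjugate l k" for k
    using less_conjugate_iff[OF assms] by (meson Suc_lessD linorder_not_less order_refl)
  show "conjugate l k = 0" if "k \<ge> psize l" for k
    using is_partition_le_psize[OF assms, of 0] less_conjugate_iff[OF assms, of 0 k] that by simp
qed

lemma conjugate_conjugate:
  assumes "is_partition l"
  shows "conjugate (conjugate l) = l"
  by (rule ext) (simp add: conjugate_def[of "conjugate l"] less_conjugate_iff[OF assms])

lemma psize_conjugate:
  assumes "is_partition l"
  shows "psize (conjugate l) = psize l"
proof -
  \<comment> \<open>The size is the number of cells of the diagram, which reflection preserves.\<close>
  have cells: "psize p = card {(i, k). k < p i}" if "is_partition p" for p
  proof -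
    have "{(i, k). k < p i} = (SIGMA i:{i. p i \<noteq> 0}. {..<p i})" by auto
    then show ?thesis
      using that by (simp add: psize_def is_partition_def)
  qed
  have "bij_betw prod.swap {(i, k). k < l i} {(k, i). i < conjugate l k}"
    by (rule bij_betw_byWitness[where f' = prod.swap])
       (auto simp: less_conjugate_iff[OF assms])
  then show ?thesis
    using cells[OF assms] cells[OF is_partition_conjugate[OF assms]] bij_betw_same_card by fastforce
qed

text \<open>The gap of the conjugate at \<open>k\<close> is the multiplicity of the part \<open>Suc k\<close>: conjugates are indexed
  from \<open>0\<close>, so that \<open>conjugate l k\<close> counts the parts of size at least \<open>Suc k\<close>.\<close>

lemma repetition_iff_conjugate_gap:
  assumes "is_partition l"
  shows "(\<exists>i. l i = l (Suc i) \<and> l i = Suc k) \<longleftrightarrow> \<not> conjugate l k - conjugate l (Suc k) \<le> 1"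
proof
  assume "\<exists>i. l i = l (Suc i) \<and> l i = Suc k"
  then obtain i where "l i = Suc k" "l (Suc i) = Suc k" by auto
  then have "Suc i < conjugate l k" "\<not> i < conjugate l (Suc k)"
    using less_conjugate_iff[OF assms] by simp_all
  then show "\<not> conjugate l k - conjugate l (Suc k) \<le> 1" by linarith
next
  assume gap: "\<not> conjugate l k - conjugate l (Suc k) \<le> 1"
  \<comment> \<open>The first column of height at most \<open>Suc k\<close>.\<close>
  let ?i = "conjugate l (Suc k)"
  have "k < l (Suc ?i)"
    using less_conjugate_iff[OF assms] gap by (metis One_nat_def Suc_lessI linorder_not_le less_diff_conv plus_1_eq_Suc)
  moreover have "\<not> Suc k < l ?i"
    using less_conjugate_iff[OF assms] by blast
  moreover have "l (Suc ?i) \<le> l ?i"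
    using assms by (simp add: is_partition_def)
  ultimately show "\<exists>i. l i = l (Suc i) \<and> l i = Suc k"
    by (intro exI[of _ ?i]) linarith
qed

text \<open>The set \<open>V\<close> collects the values allowed to repeat: the multiples of \<open>Suc n\<close> give the proper
  walls, and \<open>{0}\<close> the strict partitions. It must contain \<open>0\<close>, since every partition ends in zeros.\<close>

lemma card_of_size_conjugate:
  assumes "0 \<in> V"
  shows "card (of_size {l. is_partition l \<and> (\<forall>i. l i = l (Suc i) \<longrightarrow> l i \<in> V)} m) =
    card (of_size {p. is_partition p \<and> (\<forall>k. Suc k \<notin> V \<longrightarrow> p k - p (Suc k) \<le> 1)} m)"
    (is "card (of_size ?A m) = card (of_size ?B m)")
proof -
  have "l \<in> ?A \<longleftrightarrow> conjugate l \<in> ?B" if "is_partition l" for l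
  proof -
    have "(\<forall>i. l i = l (Suc i) \<longrightarrow> l i \<in> V) \<longleftrightarrow>
        (\<forall>k. Suc k \<notin> V \<longrightarrow> \<not> (\<exists>i. l i = l (Suc i) \<and> l i = Suc k))"
      using assms by (metis not0_implies_Suc)
    then show ?thesis
      using that is_partition_conjugate repetition_iff_conjugate_gap[OF that] by simp
  qed
  note AB = this
  have BA: "conjugate p \<in> ?A" if "p \<in> ?B" for p
    using AB[of "conjugate p"] that is_partition_conjugate conjugate_conjugate by auto
  have "bij_betw conjugate (of_size ?A m) (of_size ?B m)"
  proof (rule bij_betw_byWitness[where f' = conjugate])
    show "conjugate ` of_size ?A m \<subseteq> of_size ?B m"
      using AB psize_conjugate by (fastforce simp: of_size_def)
    show "conjugate ` of_size ?B m \<subseteq> of_size ?A m"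
      using BA psize_conjugate by (fastforce simp: of_size_def)
  qed (auto simp: of_size_def conjugate_conjugate)
  then show ?thesis by (rule bij_betw_same_card)
qed

section \<open>Strict partitions as remainders of proper walls\<close>

text \<open>A partition all of whose gaps at \<open>k\<close> vanish unless \<open>D\<close> divides \<open>Suc k\<close> is constant on the
  blocks \<open>{b * D..<b * D + D}\<close>. Such partitions are the conjugates of the partitions into multiples
  of \<open>D\<close>, and reading off one value per block identifies them with all partitions.\<close>

lemma partition_blocks:
  assumes "is_partition c" "D > 0"
  shows "is_partition (\<lambda>k. c (k div D))" "psize (\<lambda>k. c (k div D)) = D * psize c"
proof -
  have zero: "c (k div D) = 0" if "k \<ge> psize c * D" for k
    using that assms is_partition_zero by (simp add: less_eq_div_iff_mult_less_eq)
  show "is_partition (\<lambda>k. c (k div D))"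
    using zero partition_antimono[OF assms(1)] by (intro is_partitionI) (auto intro: div_le_mono)
  have "psize (\<lambda>k. c (k div D)) = (\<Sum>k<psize c * D. c (k div D))"
    by (rule psize_eq_sum) (rule zero)
  also have "\<dots> = (\<Sum>b<psize c. \<Sum>k\<in>{b * D..<b * D + D}. c (k div D))"
    by (rule sum.nat_group[symmetric])
  also have "\<dots> = (\<Sum>b<psize c. D * c b)"
  proof (rule sum.cong[OF refl])
    fix b
    have "k div D = b" if "k \<in> {b * D..<b * D + D}" for k
      using that by (intro div_nat_eqI) (auto simp: algebra_simps)
    then show "(\<Sum>k\<in>{b * D..<b * D + D}. c (k div D)) = D * c b" by simp
  qed
  also have "\<dots> = D * psize c"
    by (simp only: psize_eq_sum[of "psize c" c, OF is_partition_zero[OF assms(1)], symmetric]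
        flip: sum_distrib_left)
  finally show "psize (\<lambda>k. c (k div D)) = D * psize c" .
qed

lemma constant_on_blocks:
  fixes c :: "nat \<Rightarrow> nat"
  assumes "D > 0" "\<And>k. \<not> D dvd Suc k \<Longrightarrow> c k = c (Suc k)"
  shows "c k = c (k div D * D)"
proof (induction k)
  case (Suc k)
  show ?case
  proof (cases "D dvd Suc k")
    case False
    then have "Suc k div D = k div D"
      by (simp add: div_Suc mod_eq_0_iff_dvd)
    then show ?thesis using Suc assms(2)[OF False] by simp
  qed simp
qed simp

text \<open>Division of the gaps by \<open>2\<close> is, on conjugates, the removal of equal parts in pairs. A gap of at
  most \<open>1\<close> has quotient \<open>0\<close>, so the quotient is constant on blocks of length \<open>D\<close>, and every
  partition stretched by \<open>D\<close> occurs as a quotient.\<close>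

lemma bij_conjugate_strict:
  assumes D: "D > 0"
  shows "bij_betw (\<lambda>(s, c) k. s k + 2 * c (k div D))
    ({p. is_partition p \<and> (\<forall>k. p k - p (Suc k) \<le> 1)} \<times> Collect is_partition)
    {p. is_partition p \<and> (\<forall>k. \<not> D dvd Suc k \<longrightarrow> p k - p (Suc k) \<le> 1)}"
    (is "bij_betw ?f ?A ?B")
proof -
  have inj: "inj_on ?f ?A"
  proof (rule inj_onI, clarify)
    fix s c s' c'
    assume *: "is_partition s" "is_partition c" "is_partition s'" "is_partition c'"
      and gap: "\<forall>k. s k - s (Suc k) \<le> 1" "\<forall>k. s' k - s' (Suc k) \<le> 1"
      and eq: "(\<lambda>k. s k + 2 * c (k div D)) = (\<lambda>k. s' k + 2 * c' (k div D))"
    have "s = s' \<and> (\<lambda>k. c (k div D)) = (\<lambda>k. c' (k div D))"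
      using * gap partition_blocks(1)[OF _ D]
      by (intro partition_division_unique[where e = "\<lambda>_. 0", OF _ _ _ _ eq])
         (auto simp: less_Suc_eq_le numeral_2_eq_2)
    moreover from this have "c b = c' b" for b
      using fun_cong[of "\<lambda>k. c (k div D)" "\<lambda>k. c' (k div D)" "b * D"] D by simp
    ultimately show "s = s' \<and> c = c'" by auto
  qed
  have sub: "?f x \<in> ?B" if "x \<in> ?A" for x
  proof -
    obtain s c where x: "x = (s, c)" by force
    have s: "is_partition s" "\<And>k. s k - s (Suc k) \<le> 1" and c: "is_partition c"
      using that by (auto simp: x)
    have "s k + 2 * c (k div D) - (s (Suc k) + 2 * c (Suc k div D)) \<le> 1"
      if "\<not> D dvd Suc k" for k
    proof -
      have "Suc k div D = k div D"
        using that by (simp add: div_Suc mod_eq_0_iff_dvd)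
      then show ?thesis using s(2)[of k] by simp
    qed
    then show ?thesis
      using is_partition_add_mult[OF s(1) partition_blocks(1)[OF c D]] by (simp add: x)
  qed
  have sur: "p \<in> ?f ` ?A" if p: "p \<in> ?B" for p
  proof -
    have part: "is_partition p" using p by simp
    obtain s b where *: "is_partition s" "is_partition b"
      and eq: "p = (\<lambda>k. s k + 2 * b k)"
      and s: "\<And>k. s k - s (Suc k) < 0 + 2"
      and b: "\<And>k. b k - b (Suc k) = (p k - p (Suc k) - 0) div 2"
      using partition_division_exists[OF part, of 2, where e = "\<lambda>_. 0"] by auto
    define c where "c j = b (j * D)" for j
    have "b k = b (Suc k)" if "\<not> D dvd Suc k" for k
    proof -
      have "p k - p (Suc k) \<le> 1" using p that by simp
      then have "b k - b (Suc k) = 0" using b[of k] by simp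
      then show ?thesis using * unfolding is_partition_def by (simp add: le_antisym)
    qed
    then have bc: "b k = c (k div D)" for k
      unfolding c_def by (rule constant_on_blocks[OF D])
    have "is_partition c"
    proof (rule is_partitionI)
      show "c (Suc j) \<le> c j" for j
        unfolding c_def by (rule partition_antimono[OF *(2)]) simp
      show "c j = 0" if "j \<ge> psize b" for j
        unfolding c_def
        using that D by (intro is_partition_zero[OF *(2)]) (metis le_trans mult_le_mono2 nat_mult_1_right One_nat_def Suc_leI)
    qed
    then have "(s, c) \<in> ?A" using * s by (auto simp: less_Suc_eq_le numeral_2_eq_2)
    moreover have "p = ?f (s, c)" using eq bc by simp
    ultimately show ?thesis by blast
  qed
  show ?thesis
    using inj sub sur unfolding bij_betw_def by blast
qed

section \<open>Counting\<close>

lemma card_of_size_division: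
  assumes bij: "bij_betw f (R \<times> Collect is_partition) F"
    and R: "\<And>r. r \<in> R \<Longrightarrow> is_partition r"
    and size: "\<And>r c. r \<in> R \<Longrightarrow> is_partition c \<Longrightarrow> psize (f (r, c)) = psize r + M * psize c"
    and M: "M > 0"
  shows "card (of_size F m) =
    (\<Sum>j | M * j \<le> m. card (of_size R (m - M * j)) * card (of_size (Collect is_partition) j))"
proof -
  let ?P = "Collect is_partition"
  let ?J = "{j. M * j \<le> m}"
  let ?X = "\<lambda>j. of_size R (m - M * j) \<times> of_size ?P j"
  have "?J \<subseteq> {..m}"
    using M by (auto intro: order.trans[rotated])
  then have J: "finite ?J" by (rule finite_subset) simp
  have "f ` (\<Union>j\<in>?J. ?X j) = of_size F m"
  proof
    show "f ` (\<Union>j\<in>?J. ?X j) \<subseteq> of_size F m"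
      using bij_betwE[OF bij] size by (auto simp: of_size_def)
    show "of_size F m \<subseteq> f ` (\<Union>j\<in>?J. ?X j)"
    proof
      fix l assume l: "l \<in> of_size F m"
      then obtain r c where rc: "r \<in> R" "is_partition c" "l = f (r, c)"
        using bij by (auto simp: of_size_def bij_betw_def)
      then have "psize r + M * psize c = m" using l size by (simp add: of_size_def)
      then have "(r, c) \<in> ?X (psize c)" "psize c \<in> ?J"
        using rc by (auto simp: of_size_def)
      then show "l \<in> f ` (\<Union>j\<in>?J. ?X j)" using rc(3) by blast
    qed
  qed
  moreover have "inj_on f (\<Union>j\<in>?J. ?X j)"
    by (rule inj_on_subset[OF bij_betw_imp_inj_on[OF bij]]) (auto simp: of_size_def)
  ultimately have "card (of_size F m) = card (\<Union>j\<in>?J. ?X j)"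
    using card_image[of f "\<Union>j\<in>?J. ?X j"] by simp
  also have "\<dots> = (\<Sum>j\<in>?J. card (?X j))"
    using J R by (intro card_UN_disjoint) (auto intro!: finite_cartesian_product finite_of_size, auto simp: of_size_def)
  finally show ?thesis by (simp add: card_cartesian_product)
qed

text \<open>In the convolution at \<open>m\<close>, all summands with \<open>j > 0\<close> involve values of \<open>a\<close> and \<open>b\<close> below \<open>m\<close>,
  which agree by induction; what remains is the summand for \<open>j = 0\<close>.\<close>

lemma convolution_cancel:
  fixes a b p :: "nat \<Rightarrow> nat"
  assumes M: "M > 0" and p0: "p 0 > 0"
    and eq: "\<And>m. (\<Sum>j | M * j \<le> m. a (m - M * j) * p j) = (\<Sum>j | M * j \<le> m. b (m - M * j) * p j)"
  shows "a m = b m"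
proof (induction m rule: less_induct)
  case (less m)
  let ?J = "{j. M * j \<le> m}"
  have "?J \<subseteq> {..m}"
    using M by (auto intro: order.trans[rotated])
  then have J: "finite ?J" by (rule finite_subset) simp
  have split: "(\<Sum>j\<in>?J. f (m - M * j) * p j) = f m * p 0 + (\<Sum>j\<in>?J - {0}. f (m - M * j) * p j)"
    for f :: "nat \<Rightarrow> nat"
    using sum.remove[OF J, of 0 "\<lambda>j. f (m - M * j) * p j"] by simp
  have "(\<Sum>j\<in>?J - {0}. a (m - M * j) * p j) = (\<Sum>j\<in>?J - {0}. b (m - M * j) * p j)"
  proof (rule sum.cong[OF refl])
    fix j assume "j \<in> ?J - {0}"
    then have "0 < M * j" "M * j \<le> m" using M by auto
    then have "m - M * j < m" by linarith
    then show "a (m - M * j) * p j = b (m - M * j) * p j" using less by simp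
  qed
  then have "a m * p 0 = b m * p 0"
    using eq[of m] split[of a] split[of b] by linarith
  then show ?case using p0 by simp
qed

theorem corollary3p3:
  fixes m n :: nat
  assumes "n \<ge> 1"
  shows "card (of_size (reduced_walls n) m) = card (of_size strict_partitions m)"
proof -
  let ?P = "Collect is_partition" and ?M = "2 * Suc n"
  let ?S = "{p. is_partition p \<and> (\<forall>k. p k - p (Suc k) \<le> 1)}"
  let ?F = "{p. is_partition p \<and> (\<forall>k. \<not> Suc n dvd Suc k \<longrightarrow> p k - p (Suc k) \<le> 1)}"
  have walls: "proper_walls n = {l. is_partition l \<and> (\<forall>i. l i = l (Suc i) \<longrightarrow> Suc n dvd l i)}"
    by (auto simp: proper_walls_iff)
  have F: "card (of_size (proper_walls n) k) = card (of_size ?F k)" for k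
    using card_of_size_conjugate[of "{v. Suc n dvd v}" k]
    by (simp add: walls)
  have S: "card (of_size strict_partitions k) = card (of_size ?S k)" for k
    using card_of_size_conjugate[of "{0}" k] by (simp add: strict_partitions_def)
  have K: "card (of_size (proper_walls n) k) =
    (\<Sum>j | ?M * j \<le> k. card (of_size (reduced_walls n) (k - ?M * j)) * card (of_size ?P j))" for k
    by (rule card_of_size_division[OF bij_reduced_walls])
       (auto simp: reduced_walls_iff psize_add_mult simp del: mult_Suc mult_Suc_right)
  have S': "card (of_size ?F k) =
    (\<Sum>j | ?M * j \<le> k. card (of_size ?S (k - ?M * j)) * card (of_size ?P j))" for k
    by (rule card_of_size_division[OF bij_conjugate_strict])
       (auto simp: psize_add_mult partition_blocks simp del: mult_Suc mult_Suc_right)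
  have P0: "card (of_size ?P 0) > 0"
  proof -
    have "(\<lambda>_. 0) \<in> of_size ?P 0"
      by (simp add: of_size_def is_partition_def psize_def)
    then show ?thesis
      using finite_of_size[of ?P 0] by (auto simp: card_gt_0_iff)
  qed
  have "card (of_size (reduced_walls n) m) = card (of_size ?S m)"
  proof (rule convolution_cancel[where M = ?M
        and a = "\<lambda>i. card (of_size (reduced_walls n) i)"
        and b = "\<lambda>i. card (of_size ?S i)" and p = "\<lambda>j. card (of_size ?P j)", OF _ P0])
    show "(\<Sum>j | ?M * j \<le> k. card (of_size (reduced_walls n) (k - ?M * j)) * card (of_size ?P j)) =
      (\<Sum>j | ?M * j \<le> k. card (of_size ?S (k - ?M * j)) * card (of_size ?P j))" for k
      by (simp only: K[symmetric] S'[symmetric] F)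
  qed simp
  then show ?thesis by (simp only: S)
qed

end
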